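(* Let $n,m\ge1$, $u\in\mathbb{R}^n$, $K\in\mathbb{R}^{n\times n}$ symmetric positive definite, $A\in\mathbb{R}^{m\times n}$, $b\in\mathbb{R}^m$, and $\mathcal{C}=\{\mathbf{g}\in\mathbb{R}^n:A\mathbf{g}+b\ge0\}$. Suppose $\mathbf{g}=(g(z_1),\dots,g(z_n))$ has the prior $CGP(u,K,\mathcal{C})$ and that, conditionally on $\mathbf{g}$, the observations $y_i\in\{0,1\}$ are independent with $y_i\sim\mathrm{Bernoulli}(p_i)$, $p_i=\Phi(g(z_i))$, where $\Phi$ is the standard normal cumulative distribution function. Let $D=\mathrm{diag}(2y_1-1,\dots,2y_n-1)$. Then the posterior distribution of $\mathbf{g}$ given $\mathbf{y}=(y_1,\dots,y_n)^\top$ is $CGP(\mu',K',\mathcal{C}')$ with $$\mu'=u,\qquad K'=K,\qquad \mathcal{C}'=\left\{\mathbf{g}:\begin{bmatrix}A\\ D\end{bmatrix}\mathbf{g}+\begin{bmatrix}b\\ 0\end{bmatrix}\ge0\right\}.$$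
   Context: For $u\in\mathbb{R}^n$, $K\in\mathbb{R}^{n\times n}$ symmetric positive definite and $\mathcal{C}=\{\mathbf{g}:A\mathbf{g}+b\ge0\}$ specified by $(A,b)$ with $A\in\mathbb{R}^{r\times n}$, $b\in\mathbb{R}^r$, the finite-dimensional constrained Gaussian process distribution $CGP(u,K,\mathcal{C})$ is the probability distribution on $\mathbb{R}^n$ with density proportional to $\phi(\mathbf{g}\mid u,K)\,\Phi_r(A\mathbf{g}+b)$. Here $\phi(\cdot\mid u,K)$ is the density of $N(u,K)$ and $\Phi_r$ is the cumulative distribution function of the standard Gaussian $N(0,I_r)$ on $\mathbb{R}^r$. The constraint is soft and depends on the pair $(A,b)$; for $\mathcal{C}'$ the pair is the stacked matrix and vector displayed in the claim. *)

theory Defs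
  imports "HOL-Probability.Probability"
begin

definition sym_pos_def :: "real ^ 'n ^ 'n \<Rightarrow> bool" where
  "sym_pos_def K \<longleftrightarrow> transpose K = K \<and> (\<forall>x. x \<noteq> 0 \<longrightarrow> x \<bullet> (K *v x) > 0)"

definition mvn_density :: "real ^ 'n \<Rightarrow> real ^ 'n ^ 'n \<Rightarrow> real ^ 'n \<Rightarrow> real" where
  "mvn_density u K g =
     exp (- ((g - u) \<bullet> (matrix_inv K *v (g - u))) / 2) / sqrt ((2 * pi) ^ CARD('n) * det K)"

(* The order on real ^ 'r is componentwise, so {..w} is the lower orthant with corner w. *)
definition std_mvn_cdf :: "real ^ 'r \<Rightarrow> real" where
  "std_mvn_cdf w = measure (density lborel (\<lambda>x. ennreal (mvn_density 0 (mat 1) x))) {..w}"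

definition std_normal_cdf :: "real \<Rightarrow> real" where
  "std_normal_cdf = cdf std_normal_distribution"

definition cgp_weight ::
  "real ^ 'n \<Rightarrow> real ^ 'n ^ 'n \<Rightarrow> (real ^ 'n ^ 'r) \<times> (real ^ 'r) \<Rightarrow> real ^ 'n \<Rightarrow> real" where
  "cgp_weight u K C g = mvn_density u K g * std_mvn_cdf (fst C *v g + snd C)"

(* The constraint {g. A *v g + b \<ge> 0} is represented by the pair (A, b): the distribution
   depends on the pair and not only on the set. *)
definition CGP ::
  "real ^ 'n \<Rightarrow> real ^ 'n ^ 'n \<Rightarrow> (real ^ 'n ^ 'r) \<times> (real ^ 'r) \<Rightarrow> (real ^ 'n) measure" where
  "CGP u K C = density lborel
     (\<lambda>g. ennreal (cgp_weight u K C g) / (\<integral>\<^sup>+ h. ennreal (cgp_weight u K C h) \<partial>lborel))"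

definition stack_mat :: "real ^ 'n ^ 'r \<Rightarrow> real ^ 'n ^ 's \<Rightarrow> real ^ 'n ^ ('r + 's)" where
  "stack_mat A D = (\<chi> k. case k of Inl i \<Rightarrow> A $ i | Inr j \<Rightarrow> D $ j)"

definition stack_vec :: "real ^ 'r \<Rightarrow> real ^ 's \<Rightarrow> real ^ ('r + 's)" where
  "stack_vec b c = (\<chi> k. case k of Inl i \<Rightarrow> b $ i | Inr j \<Rightarrow> c $ j)"

definition diag_mat :: "('n \<Rightarrow> real) \<Rightarrow> real ^ 'n ^ 'n" where
  "diag_mat d = (\<chi> i j. if i = j then d i else 0)"

definition sigma_gen :: "'w measure \<Rightarrow> 'a measure \<Rightarrow> ('w \<Rightarrow> 'a) \<Rightarrow> 'w measure" where
  "sigma_gen M N X = vimage_algebra (space M) X N"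

definition cprob :: "'w measure \<Rightarrow> 'w measure \<Rightarrow> 'w set \<Rightarrow> 'w \<Rightarrow> real" where
  "cprob M F E = real_cond_exp M F (indicator E)"

definition cond_indep_vars ::
  "'w measure \<Rightarrow> 'w measure \<Rightarrow> ('i \<Rightarrow> 'b measure) \<Rightarrow> ('i \<Rightarrow> 'w \<Rightarrow> 'b) \<Rightarrow> 'i set \<Rightarrow> bool" where
  "cond_indep_vars M F N X I \<longleftrightarrow>
     (\<forall>i\<in>I. X i \<in> measurable M (N i)) \<and>
     (\<forall>J B. J \<subseteq> I \<longrightarrow> finite J \<longrightarrow> (\<forall>j\<in>J. B j \<in> sets (N j)) \<longrightarrow>
        (AE \<omega> in M. cprob M F {\<omega> \<in> space M. \<forall>j\<in>J. X j \<omega> \<in> B j} \<omega> =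
                    (\<Prod>j\<in>J. cprob M F {\<omega> \<in> space M. X j \<omega> \<in> B j} \<omega>)))"

definition cond_distr_pmf ::
  "'w measure \<Rightarrow> 'w measure \<Rightarrow> ('w \<Rightarrow> 'b) \<Rightarrow> ('w \<Rightarrow> 'b pmf) \<Rightarrow> bool" where
  "cond_distr_pmf M F X p \<longleftrightarrow> X \<in> measurable M (count_space UNIV) \<and>
     (\<forall>B. AE \<omega> in M. cprob M F {\<omega> \<in> space M. X \<omega> \<in> B} \<omega> = measure_pmf.prob (p \<omega>) B)"

(* Posterior of G given that the random vector Y takes the value y.  This is elementary
   conditioning on an event, so it is meaningful only when that event has positive probability. *)
definition posterior ::
  "'w measure \<Rightarrow> 'a measure \<Rightarrow> ('w \<Rightarrow> 'a) \<Rightarrow> ('i \<Rightarrow> 'w \<Rightarrow> 'b) \<Rightarrow> ('i \<Rightarrow> 'b) \<Rightarrow> 'a measure" where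
  "posterior M N G Y y = distr (uniform_measure M {\<omega> \<in> space M. \<forall>i. Y i \<omega> = y i}) N G"

end

theory Submission
  imports Defs
begin

text \<open>
  The standard Gaussian distribution function factorises over coordinates, and
  \<open>1 - \<Phi> x = \<Phi> (- x)\<close>, so the probit likelihood of \<open>y\<close> given \<open>g\<close> is exactly the distribution
  function of \<open>N (0, I)\<close> at \<open>D g\<close>, and it multiplies the prior weight into the weight of the
  stacked constraint. No Gaussian integral has to be evaluated: the normalising constant of the
  prior is finite and positive because the prior is the law of \<open>G\<close>.
\<close>

section \<open>The standard Gaussian distribution function on vectors\<close>

lemma nn_integral_lborel_vec_prod:
  fixes f :: "'n::finite \<Rightarrow> real \<Rightarrow> ennreal"
  assumes "\<And>i. f i \<in> borel_measurable borel"
  shows "(\<integral>\<^sup>+x. (\<Prod>i\<in>UNIV. f i (x $ i)) \<partial>(lborel :: (real ^ 'n) measure)) =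
    (\<Prod>i\<in>UNIV. \<integral>\<^sup>+t. f i t \<partial>lborel)"
proof -
  \<comment> \<open>\<open>nn_integral_lborel_prod\<close> is indexed by basis vectors; the
    bijection between \<open>i\<close> and \<open>axis i 1\<close> turns this into indexing by
    coordinates.\<close>
  have Basis_prod: "(\<Prod>b\<in>(Basis :: (real ^ 'n) set). h b) = (\<Prod>i\<in>UNIV. h (axis i 1))"
    for h :: "real ^ 'n \<Rightarrow> ennreal"
    by (simp add: Basis_vec_def UNION_singleton_eq_range prod.reindex inj_on_def axis_eq_axis)
  have "(\<integral>\<^sup>+x. (\<Prod>b\<in>Basis. f (axis_index b) (x \<bullet> b)) \<partial>(lborel :: (real ^ 'n) measure)) =
      (\<Prod>b\<in>(Basis :: (real ^ 'n) set). \<integral>\<^sup>+t. f (axis_index b) t \<partial>lborel)"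
    using assms by (intro nn_integral_lborel_prod) auto
  then show ?thesis
    by (simp add: Basis_prod inner_axis)
qed

lemma mvn_density_std:
  fixes x :: "real ^ 'n"
  shows "mvn_density 0 (mat 1) x = (\<Prod>i\<in>UNIV. std_normal_density (x $ i))"
proof -
  \<comment> \<open>\<open>matrix_inv\<close> is a Hilbert choice, so its specification becomes
    available only once some two-sided inverse is exhibited.\<close>
  have "\<exists>B :: real ^ 'n ^ 'n. mat 1 ** B = mat 1 \<and> B ** mat 1 = mat 1"
    by (intro exI[of _ "mat 1"]) simp
  from someI_ex[OF this] have "matrix_inv (mat 1 :: real ^ 'n ^ 'n) = mat 1"
    by (simp add: matrix_inv_def)
  moreover have "sqrt ((2 * pi) ^ CARD('n)) = sqrt (2 * pi) ^ CARD('n)"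
    by (rule real_sqrt_power)
  ultimately show ?thesis
    by (simp add: mvn_density_def std_normal_density_def prod_dividef exp_sum[symmetric]
        inner_vec_def sum_negf sum_divide_distrib power2_eq_square
        del: real_sqrt_mult power_mult_distrib)
qed

lemma emeasure_std_normal_atMost:
  "emeasure std_normal_distribution {..x} = ennreal (std_normal_cdf x)"
proof -
  interpret real_distribution std_normal_distribution
    by (rule real_dist_normal_dist)
  show ?thesis
    by (simp add: std_normal_cdf_def cdf_def emeasure_eq_measure)
qed

text \<open>The density and the indicator of the orthant \<open>{..w}\<close> are both products over
  the coordinates, so the integral splits by Tonelli.\<close>

lemma std_mvn_cdf_eq_prod: "std_mvn_cdf w = (\<Prod>i\<in>UNIV. std_normal_cdf (w $ i))"
proof -
  have [measurable]: "(\<lambda>x. ennreal (mvn_density 0 (mat 1) x)) \<in> borel_measurable borel"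
    unfolding mvn_density_std by measurable
  have "emeasure (density lborel (\<lambda>x. ennreal (mvn_density 0 (mat 1) x))) {..w} =
      (\<integral>\<^sup>+x. ennreal (mvn_density 0 (mat 1) x) * indicator {..w} x \<partial>lborel)"
    by (subst emeasure_density) auto
  also have "\<dots> = (\<integral>\<^sup>+x. (\<Prod>i\<in>UNIV. ennreal (std_normal_density (x $ i)) *
      indicator {..w $ i} (x $ i)) \<partial>lborel)"
  proof (intro nn_integral_cong)
    fix x :: "real ^ 'a"
    have "(indicator {..w} x :: ennreal) = (\<Prod>i\<in>UNIV. indicator {..w $ i} (x $ i))"
      by (auto simp: indicator_def less_eq_vec_def prod_zero_iff)
    then show "ennreal (mvn_density 0 (mat 1) x) * indicator {..w} x =
      (\<Prod>i\<in>UNIV. ennreal (std_normal_density (x $ i)) * indicator {..w $ i} (x $ i))"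
      by (simp add: mvn_density_std prod_ennreal prod.distrib)
  qed
  also have "\<dots> = (\<Prod>i\<in>UNIV. \<integral>\<^sup>+t. ennreal (std_normal_density t) * indicator {..w $ i} t \<partial>lborel)"
    by (rule nn_integral_lborel_vec_prod[of "\<lambda>i t. ennreal (std_normal_density t) * indicator {..w $ i} t"])
      measurable
  also have "\<dots> = (\<Prod>i\<in>UNIV. emeasure std_normal_distribution {..w $ i})"
    by (intro prod.cong refl) (subst emeasure_density, auto)
  also have "\<dots> = ennreal (\<Prod>i\<in>UNIV. std_normal_cdf (w $ i))"
    unfolding emeasure_std_normal_atMost
    by (intro prod_ennreal) (simp add: std_normal_cdf_def cdf_def)
  finally show ?thesis
    by (simp add: std_mvn_cdf_def measure_def prod_nonneg std_normal_cdf_def cdf_def)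
qed

section \<open>Bounds, reflection and measurability of the scalar distribution function\<close>

lemma std_normal_cdf_le_1: "std_normal_cdf x \<le> 1"
proof -
  interpret real_distribution std_normal_distribution
    by (rule real_dist_normal_dist)
  show ?thesis
    by (simp add: std_normal_cdf_def cdf_def)
qed

text \<open>An everywhere positive density cannot vanish almost everywhere on a half-line. The
  strict inequality is what later gives the observed data positive probability.\<close>

lemma std_normal_cdf_pos: "std_normal_cdf x > 0"
proof -
  have "\<not> (AE t in lborel. ennreal (std_normal_density t) * indicator {..x} t = 0)"
  proof
    assume "AE t in lborel. ennreal (std_normal_density t) * indicator {..x} t = 0"
    then have "AE t in lborel. t \<notin> {..x}"
    proof (rule AE_mp, intro AE_I2 impI)
      fix t assume "ennreal (std_normal_density t) * indicator {..x} t = 0"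
      moreover have "std_normal_density t > 0"
        by (rule normal_density_pos) simp
      ultimately show "t \<notin> {..x}"
        by (auto simp: indicator_def split: if_splits)
    qed
    \<comment> \<open>Any bounded piece of the half-line would do; this one has Lebesgue measure
      1.\<close>
    then have "AE t in lborel. t \<notin> {x - 1..x}"
      by (rule AE_mp) auto
    then have "emeasure lborel {x - 1..x} = 0"
      by (subst (asm) AE_iff_null_sets[symmetric]) (auto simp: null_sets_def)
    then show False
      by simp
  qed
  then have "emeasure std_normal_distribution {..x} \<noteq> 0"
    by (subst emeasure_density) (auto simp: nn_integral_0_iff_AE)
  then show ?thesis
    \<comment> \<open>\<open>ennreal\<close> sends every nonpositive real to 0, so a nonzero mass
      forces a positive real value.\<close>
    by (metis emeasure_std_normal_atMost ennreal_neg not_le)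
qed

text \<open>The density is even, so the reflection \<open>t\<close> to \<open>-t\<close> carries
  \<open>{..- x}\<close> to \<open>{x..}\<close>. The endpoint has no mass, which leaves the
  complement of \<open>{..x}\<close>.\<close>

lemma std_normal_cdf_minus: "std_normal_cdf (- x) = 1 - std_normal_cdf x"
proof -
  interpret real_distribution std_normal_distribution
    by (rule real_dist_normal_dist)
  have "emeasure std_normal_distribution {..- x} =
      (\<integral>\<^sup>+t. ennreal (std_normal_density t) * indicator {..- x} t \<partial>lborel)"
    by (subst emeasure_density) auto
  also have "\<dots> = (\<integral>\<^sup>+t. ennreal (std_normal_density t) * indicator {x..} t \<partial>lborel)"
    by (subst nn_integral_real_affine[of _ "-1" 0])
      (auto intro!: nn_integral_cong simp: indicator_def std_normal_density_def)
  also have "\<dots> = (\<integral>\<^sup>+t. ennreal (std_normal_density t) * indicator {x<..} t \<partial>lborel)"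
    using AE_lborel_singleton[of x] by (intro nn_integral_cong_AE) (auto simp: indicator_def)
  also have "\<dots> = emeasure std_normal_distribution {x<..}"
    by (subst emeasure_density) auto
  also have "{x<..} = space std_normal_distribution - {..x}"
    by auto
  finally have "measure std_normal_distribution {..- x} =
      measure std_normal_distribution (space std_normal_distribution - {..x})"
    by (simp add: measure_def)
  also have "\<dots> = 1 - measure std_normal_distribution {..x}"
    by (intro prob_compl) simp
  finally show ?thesis
    by (simp add: std_normal_cdf_def cdf_def)
qed

lemma borel_measurable_std_normal_cdf [measurable]: "std_normal_cdf \<in> borel_measurable borel"
proof (rule borel_measurable_mono)
  interpret real_distribution std_normal_distribution
    by (rule real_dist_normal_dist)
  show "mono std_normal_cdf"
    by (auto simp: mono_def std_normal_cdf_def intro: cdf_nondecreasing)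
qed

section \<open>The weight function and the probit likelihood\<close>

lemma borel_measurable_cgp_weight [measurable]:
  "cgp_weight u K C \<in> borel_measurable borel"
proof -
  have affine [measurable]: "(\<lambda>g. (C' *v g + c) $ i) \<in> borel_measurable borel"
    for C' :: "real ^ 'n ^ 'r" and c i
    by (intro borel_measurable_continuous_onI continuous_intros)
  have [measurable]: "mvn_density u K \<in> borel_measurable borel"
    unfolding mvn_density_def divide_inverse
    by (intro borel_measurable_continuous_onI continuous_intros
        bounded_linear.continuous_on[OF matrix_vector_mul_bounded_linear])
  show ?thesis
    \<comment> \<open>The Gaussian factor is measurable by continuity, the other one through its
      product form.\<close>
    unfolding cgp_weight_def[abs_def] std_mvn_cdf_eq_prod by measurable
qed

text \<open>The sign is 1 for a success and -1 for a failure; the failure probability is a value of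
  \<open>std_normal_cdf\<close> by reflection.\<close>

lemma pmf_bernoulli_std_normal_cdf:
  "pmf (bernoulli_pmf (std_normal_cdf x)) c = std_normal_cdf ((2 * of_bool c - 1) * x)"
  \<comment> \<open>\<open>bernoulli_pmf\<close> clamps its parameter to the unit interval; the two
    bounds show that the clamp has no effect here.\<close>
  using std_normal_cdf_le_1[of x] std_normal_cdf_pos[of x]
  by (cases c) (auto simp: std_normal_cdf_minus)

text \<open>The coordinates of the stacked affine map are those of \<open>A *v g + b\<close>
  followed by the numbers \<open>d i * g $ i\<close>, so the product over the sum type splits into
  the prior factor and the likelihood.\<close>

lemma cgp_weight_stack_probit:
  "cgp_weight u K (stack_mat A (diag_mat d), stack_vec b 0) g =
    cgp_weight u K (A, b) g * (\<Prod>i\<in>UNIV. std_normal_cdf (d i * g $ i))"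
proof -
  have "(diag_mat d *v g) $ i = d i * g $ i" for i
    by (simp add: diag_mat_def matrix_vector_mult_def if_distrib[of "\<lambda>c. c * _"] cong: if_cong)
  then have "(stack_mat A (diag_mat d) *v g + stack_vec b 0) $ k =
      (case k of Inl i \<Rightarrow> (A *v g + b) $ i | Inr j \<Rightarrow> d j * g $ j)" for k
    by (simp add: stack_mat_def stack_vec_def matrix_vector_mult_def split: sum.split)
  then show ?thesis
    by (simp add: cgp_weight_def std_mvn_cdf_eq_prod UNIV_Plus_UNIV[symmetric] prod.Plus
        del: UNIV_Plus_UNIV vector_add_component)
qed

section \<open>Conditional probability and Bayes' formula\<close>

text \<open>This is the averaging property that defines conditional expectation, restated as a
  nonnegative integral for a pointwise nonnegative version \<open>p\<close>.\<close>

lemma emeasure_Int_eq_nn_integral_cprob: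
  assumes "finite_measure_subalgebra M F"
    and E: "E \<in> sets M" and S: "S \<in> sets F"
    and p [measurable]: "p \<in> borel_measurable M"
    and nonneg: "\<And>\<omega>. 0 \<le> p \<omega>"
    and cprob: "AE \<omega> in M. cprob M F E \<omega> = p \<omega>"
  shows "emeasure M (E \<inter> S) = (\<integral>\<^sup>+\<omega>. ennreal (p \<omega>) * indicator S \<omega> \<partial>M)"
proof -
  interpret finite_measure_subalgebra M F by fact
  have [measurable]: "S \<in> sets M"
    using S subalg by (auto simp: subalgebra_def)
  have integrable_E: "integrable M (indicator E :: _ \<Rightarrow> real)"
    using E by (simp add: emeasure_eq_measure)
  have "integrable M p"
    using real_cond_exp_int(1)[OF integrable_E] cprob
    by (subst integrable_cong_AE[of _ _ "real_cond_exp M F (indicator E)"])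
      (auto simp: cprob_def)
  then have integrable_pS: "integrable M (\<lambda>\<omega>. indicator S \<omega> * p \<omega>)"
    using integrable_mult_indicator[of S M p] by simp
  have "measure M (E \<inter> S) = (\<integral>\<omega>\<in>S. indicator E \<omega> \<partial>M)"
    using E by (simp add: set_lebesgue_integral_def indicator_inter_arith[symmetric] Int_commute)
  also have "\<dots> = (\<integral>\<omega>\<in>S. real_cond_exp M F (indicator E) \<omega> \<partial>M)"
    by (rule real_cond_exp_intA[OF integrable_E S])
  also have "\<dots> = (\<integral>\<omega>. indicator S \<omega> * p \<omega> \<partial>M)"
    unfolding set_lebesgue_integral_def
    using cprob by (intro integral_cong_AE) (auto simp: cprob_def)
  finally have "emeasure M (E \<inter> S) = ennreal (\<integral>\<omega>. indicator S \<omega> * p \<omega> \<partial>M)"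
    by (simp add: emeasure_eq_measure)
  also have "\<dots> = (\<integral>\<^sup>+\<omega>. ennreal (indicator S \<omega> * p \<omega>) \<partial>M)"
    using nonneg by (intro nn_integral_eq_integral[symmetric] integrable_pS) auto
  finally show ?thesis
    using nonneg by (simp add: ennreal_mult ennreal_indicator mult.commute)
qed

theorem mainTheorem5:
  fixes M :: "'w measure"
    and u :: "real ^ 'n" and K :: "real ^ 'n ^ 'n"
    and A :: "real ^ 'n ^ 'm" and b :: "real ^ 'm"
    and G :: "'w \<Rightarrow> real ^ 'n" and Y :: "'n \<Rightarrow> 'w \<Rightarrow> bool"
    and y :: "'n \<Rightarrow> bool"
  assumes "prob_space M"
    and "sym_pos_def K"
    and "G \<in> borel_measurable M"
    and prior: "distr M borel G = CGP u K (A, b)"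
    and indep: "cond_indep_vars M (sigma_gen M borel G) (\<lambda>_. count_space UNIV) Y UNIV"
    and bernoulli: "\<And>i. cond_distr_pmf M (sigma_gen M borel G) (Y i)
                            (\<lambda>\<omega>. bernoulli_pmf (std_normal_cdf (G \<omega> $ i)))"
  shows "measure M {\<omega> \<in> space M. \<forall>i. Y i \<omega> = y i} > 0 \<and>
         posterior M borel G Y y =
           CGP u K (stack_mat A (diag_mat (\<lambda>i. 2 * of_bool (y i) - 1)), stack_vec b 0)"
proof -
  interpret prob_space M by fact
  note [measurable] = \<open>G \<in> borel_measurable M\<close>
  define d :: "'n \<Rightarrow> real" where "d i = 2 * of_bool (y i) - 1" for i
  define C where "C = (stack_mat A (diag_mat d), stack_vec b 0 :: real ^ ('m + 'n))"
  \<comment> \<open>\<open>q\<close> is the likelihood of \<open>y\<close> as a function of the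
    latent vector; \<open>Z\<close> and \<open>Z'\<close> below normalise the prior and the claimed
    posterior.\<close>
  define q :: "real ^ 'n \<Rightarrow> real" where "q g = (\<Prod>i\<in>UNIV. std_normal_cdf (d i * g $ i))" for g
  define F where "F = sigma_gen M borel G"
  define E where "E = {\<omega> \<in> space M. \<forall>i. Y i \<omega> = y i}"
  define Z where "Z = (\<integral>\<^sup>+ h. ennreal (cgp_weight u K (A, b) h) \<partial>lborel)"
  define Z' where "Z' = (\<integral>\<^sup>+ h. ennreal (cgp_weight u K C h) \<partial>lborel)"

  have [measurable]: "q \<in> borel_measurable borel"
    unfolding q_def by measurable
  have q_pos: "q g > 0" for g
    by (simp add: q_def prod_pos std_normal_cdf_pos)
  have weight_C: "ennreal (cgp_weight u K C g) = ennreal (cgp_weight u K (A, b) g) * ennreal (q g)" for g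
    using q_pos[of g] by (simp add: C_def q_def cgp_weight_stack_probit ennreal_mult'')

  have Y [measurable]: "Y i \<in> measurable M (count_space UNIV)" for i
    using indep by (auto simp: cond_indep_vars_def)
  have E: "E \<in> sets M"
    unfolding E_def by measurable
  have F: "finite_measure_subalgebra M F"
  proof
    show "subalgebra M F"
      unfolding F_def sigma_gen_def subalgebra_def
      by (auto simp: sets_vimage_algebra2)
  qed
  have "AE \<omega> in M. cprob M F E \<omega> = (\<Prod>i\<in>UNIV. cprob M F {\<omega> \<in> space M. Y i \<omega> \<in> {y i}} \<omega>)"
    using indep[unfolded cond_indep_vars_def, THEN conjunct2, rule_format, of UNIV "\<lambda>i. {y i}"]
    by (simp add: E_def F_def)
  moreover have "AE \<omega> in M. \<forall>i\<in>UNIV. cprob M F {\<omega> \<in> space M. Y i \<omega> \<in> {y i}} \<omega> =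
      std_normal_cdf (d i * G \<omega> $ i)"
  \<comment> \<open>There are finitely many coordinates, so one null set serves all of them.\<close>
  proof (rule AE_finite_allI)
    fix i
    have "AE \<omega> in M. cprob M F {\<omega> \<in> space M. Y i \<omega> \<in> {y i}} \<omega> =
        measure_pmf.prob (bernoulli_pmf (std_normal_cdf (G \<omega> $ i))) {y i}"
      using bernoulli[of i] unfolding cond_distr_pmf_def F_def by blast
    then show "AE \<omega> in M. cprob M F {\<omega> \<in> space M. Y i \<omega> \<in> {y i}} \<omega> = std_normal_cdf (d i * G \<omega> $ i)"
      by (simp add: measure_pmf_single pmf_bernoulli_std_normal_cdf d_def)
  qed simp
  ultimately have cprob_E: "AE \<omega> in M. cprob M F E \<omega> = q (G \<omega>)"
    by eventually_elim (simp add: q_def)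

  \<comment> \<open>Bayes' numerator: averaging the likelihood over the prior law of
    \<open>G\<close> on \<open>B\<close> multiplies the prior weight by \<open>q\<close>, which
    gives the stacked weight, still divided by the prior constant \<open>Z\<close>.\<close>
  have joint: "emeasure M (E \<inter> (G -` B \<inter> space M)) =
      (\<integral>\<^sup>+g. ennreal (cgp_weight u K C g) * indicator B g \<partial>lborel) / Z"
    if [measurable]: "B \<in> sets borel" for B
  proof -
    have "G -` B \<inter> space M \<in> sets F"
      by (simp add: F_def sigma_gen_def in_vimage_algebra)
    then have "emeasure M (E \<inter> (G -` B \<inter> space M)) =
        (\<integral>\<^sup>+\<omega>. ennreal (q (G \<omega>)) * indicator (G -` B \<inter> space M) \<omega> \<partial>M)"
      using q_pos by (intro emeasure_Int_eq_nn_integral_cprob[OF F E] cprob_E) (auto simp: less_imp_le)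
    also have "\<dots> = (\<integral>\<^sup>+\<omega>. ennreal (q (G \<omega>)) * indicator B (G \<omega>) \<partial>M)"
      by (intro nn_integral_cong) (auto simp: indicator_def)
    also have "\<dots> = (\<integral>\<^sup>+g. ennreal (q g) * indicator B g \<partial>CGP u K (A, b))"
      by (subst prior[symmetric], subst nn_integral_distr) auto
    also have "\<dots> = (\<integral>\<^sup>+g. ennreal (cgp_weight u K C g) * indicator B g / Z \<partial>lborel)"
      unfolding CGP_def Z_def[symmetric]
      by (subst nn_integral_density) (auto intro!: nn_integral_cong simp: weight_C divide_ennreal_def ac_simps)
    also have "\<dots> = (\<integral>\<^sup>+g. ennreal (cgp_weight u K C g) * indicator B g \<partial>lborel) / Z"
      by (rule nn_integral_divide) measurable
    finally show ?thesis .
  qed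

  have "emeasure (distr M borel G) UNIV = 1"
    by (simp add: emeasure_distr emeasure_space_1)
  then have "Z / Z = 1"
    unfolding prior CGP_def Z_def
    by (subst (asm) emeasure_density) (auto simp: nn_integral_divide)
  \<comment> \<open>In the extended nonnegative reals both 0/0 and top/top are 0.\<close>
  then have Z: "Z \<noteq> 0" "Z \<noteq> \<top>"
    by (auto simp: divide_ennreal_def)
  \<comment> \<open>The likelihood vanishes nowhere, so \<open>Z' = 0\<close> would make the prior
    weight vanish almost everywhere and force \<open>Z = 0\<close>.\<close>
  have "Z' \<noteq> 0"
  proof
    assume "Z' = 0"
    then have "AE g in lborel. ennreal (cgp_weight u K (A, b) g) * ennreal (q g) = 0"
      by (simp add: Z'_def weight_C nn_integral_0_iff_AE)
    then have "AE g in lborel. ennreal (cgp_weight u K (A, b) g) = 0"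
      by eventually_elim (use q_pos in \<open>auto simp: ennreal_eq_0_iff not_le[symmetric]\<close>)
    then have "Z = 0"
      unfolding Z_def by (subst nn_integral_0_iff_AE) auto
    with Z show False by simp
  qed
  have "E \<inter> (G -` UNIV \<inter> space M) = E"
    by (auto simp: E_def)
  \<comment> \<open>The case of the whole space gives the evidence, that is, the probability of the
    data.\<close>
  with joint[of UNIV] have emeasure_E: "emeasure M E = Z' / Z"
    by (simp add: Z'_def)
  then have "emeasure M E \<noteq> 0"
    using \<open>Z' \<noteq> 0\<close> Z by (simp add: divide_ennreal_def ennreal_inverse_eq_0_iff)
  then have "measure M E > 0"
    by (simp add: emeasure_eq_measure zero_less_measure_iff)
  moreover have "posterior M borel G Y y = CGP u K C"
  proof (rule measure_eqI)
    fix B assume "B \<in> sets (posterior M borel G Y y)"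
    then have B [measurable]: "B \<in> sets borel"
      by (simp add: posterior_def)
    define I where "I = (\<integral>\<^sup>+g. ennreal (cgp_weight u K C g) * indicator B g \<partial>lborel)"
    have "emeasure (posterior M borel G Y y) B = emeasure M (E \<inter> (G -` B \<inter> space M)) / emeasure M E"
      unfolding posterior_def E_def[symmetric] using E
      by (subst emeasure_distr) (auto simp: measurable_sets)
    also have "\<dots> = (I / Z) / (Z' / Z)"
      by (simp add: joint emeasure_E I_def)
    also have "\<dots> = I / Z'"
      \<comment> \<open>The common factor \<open>inverse Z\<close> cancels because it is neither 0
        nor infinite.\<close>
      unfolding divide_ennreal_def[of _ Z] using Z by (intro divide_mult_eq) auto
    also have "\<dots> = (\<integral>\<^sup>+g. ennreal (cgp_weight u K C g) * indicator B g / Z' \<partial>lborel)"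
      unfolding I_def by (rule nn_integral_divide[symmetric]) measurable
    also have "\<dots> = emeasure (CGP u K C) B"
      unfolding CGP_def Z'_def[symmetric]
      by (subst emeasure_density) (auto intro!: nn_integral_cong simp: divide_ennreal_def ac_simps)
    finally show "emeasure (posterior M borel G Y y) B = emeasure (CGP u K C) B" .
  qed (simp add: posterior_def CGP_def)
  ultimately show ?thesis
    by (simp add: E_def C_def d_def[abs_def])
qed

end
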